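(* Let $\mathbb{C}$ be a centralic category. Then the class $\mathsf{Z}(\mathbb{C})$ of all central morphisms in $\mathbb{C}$ is a right ideal of $\mathbb{C}$; that is, if $f\colon X\to Y$ is central and $x\colon S\to X$ is any morphism in $\mathbb{C}$, then $f\circ x\colon S\to Y$ is central.
   Context: A pointed category is a category with a zero object $0$; zero morphisms are also denoted $0$. For morphisms $x\colon S\to X$, $y\colon S\to Y$, $f\colon X\times Y\to Z$, write $f(x,y)$ for the composite $f\circ(x,y)\colon S\to Z$. A pointed category with finite products is called centralic if for every morphism $f\colon X\times Y\to Z$, every object $S$ and all morphisms $x,x'\colon S\to X$, $y\colon S\to Y$: $f(x,0)=f(x',0)$ implies $f(x,y)=f(x',y)$. Two morphisms $f\colon A\to X$ and $g\colon B\to X$ commute if there is a morphism $\rho\colon A\times B\to X$ (called a cooperator for $f$ and $g$) with $\rho\circ(1_A,0)=f$ and $\rho\circ(0,1_B)=g$. A morphism $f\colon A\to B$ is central if it commutes with $1_B$. *)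

theory Defs
  imports Main
begin

record ('o, 'm) category =
  Obj :: "'o set"
  Mor :: "'m set"
  Dom :: "'m \<Rightarrow> 'o"
  Cod :: "'m \<Rightarrow> 'o"
  Ide :: "'o \<Rightarrow> 'm"
  Comp :: "'m \<Rightarrow> 'm \<Rightarrow> 'm" (infixl "\<odot>\<index>" 70)

definition Hom :: "('o, 'm) category \<Rightarrow> 'o \<Rightarrow> 'o \<Rightarrow> 'm set" where
  "Hom C X Y = {f \<in> Mor C. Dom C f = X \<and> Cod C f = Y}"

text \<open>Composition is in the order of functions: \<open>g \<odot>\<^bsub>C\<^esub> f\<close> is
  \<open>f\<close> followed by \<open>g\<close>.\<close>

locale category =
  fixes C :: "('o, 'm) category" (structure)
  assumes Dom_in_Obj: "f \<in> Mor C \<Longrightarrow> Dom C f \<in> Obj C"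
    and Cod_in_Obj: "f \<in> Mor C \<Longrightarrow> Cod C f \<in> Obj C"
    and Ide_in_Hom: "X \<in> Obj C \<Longrightarrow> Ide C X \<in> Hom C X X"
    and Comp_in_Hom: "\<lbrakk>f \<in> Hom C X Y; g \<in> Hom C Y Z\<rbrakk> \<Longrightarrow> g \<odot> f \<in> Hom C X Z"
    and Comp_Ide: "f \<in> Hom C X Y \<Longrightarrow> f \<odot> Ide C X = f"
    and Ide_Comp: "f \<in> Hom C X Y \<Longrightarrow> Ide C Y \<odot> f = f"
    and Comp_assoc: "\<lbrakk>f \<in> Hom C W X; g \<in> Hom C X Y; h \<in> Hom C Y Z\<rbrakk> \<Longrightarrow>
      h \<odot> (g \<odot> f) = (h \<odot> g) \<odot> f"

definition is_zero_object :: "('o, 'm) category \<Rightarrow> 'o \<Rightarrow> bool" where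
  "is_zero_object C O' \<longleftrightarrow> O' \<in> Obj C \<and>
    (\<forall>X\<in>Obj C. (\<exists>!u. u \<in> Hom C X O') \<and> (\<exists>!v. v \<in> Hom C O' X))"

definition zero_mor :: "('o, 'm) category \<Rightarrow> 'o \<Rightarrow> 'o \<Rightarrow> 'm" where
  "zero_mor C X Y = (THE z. \<exists>O' u v. is_zero_object C O' \<and>
    u \<in> Hom C X O' \<and> v \<in> Hom C O' Y \<and> z = v \<odot>\<^bsub>C\<^esub> u)"

definition is_product ::
  "('o, 'm) category \<Rightarrow> 'i set \<Rightarrow> ('i \<Rightarrow> 'o) \<Rightarrow> 'o \<Rightarrow> ('i \<Rightarrow> 'm) \<Rightarrow> bool" where
  "is_product C I X P p \<longleftrightarrow> P \<in> Obj C \<and> (\<forall>i\<in>I. p i \<in> Hom C P (X i)) \<and>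
    (\<forall>S\<in>Obj C. \<forall>x. (\<forall>i\<in>I. x i \<in> Hom C S (X i)) \<longrightarrow>
      (\<exists>!h. h \<in> Hom C S P \<and> (\<forall>i\<in>I. p i \<odot>\<^bsub>C\<^esub> h = x i)))"

definition has_finite_products :: "('o, 'm) category \<Rightarrow> bool" where
  "has_finite_products C \<longleftrightarrow>
    (\<forall>n::nat. \<forall>X. (\<forall>i<n. X i \<in> Obj C) \<longrightarrow> (\<exists>P p. is_product C {..<n} X P p))"

definition is_binary_product ::
  "('o, 'm) category \<Rightarrow> 'o \<Rightarrow> 'o \<Rightarrow> 'o \<Rightarrow> 'm \<Rightarrow> 'm \<Rightarrow> bool" where
  "is_binary_product C X Y P p q \<longleftrightarrow>
    P \<in> Obj C \<and> p \<in> Hom C P X \<and> q \<in> Hom C P Y \<and>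
    (\<forall>S\<in>Obj C. \<forall>x\<in>Hom C S X. \<forall>y\<in>Hom C S Y.
      \<exists>!h. h \<in> Hom C S P \<and> p \<odot>\<^bsub>C\<^esub> h = x \<and> q \<odot>\<^bsub>C\<^esub> h = y)"

text \<open>A product \<open>X \<times> Y\<close> is chosen once and for all for each pair of objects. Nothing
  below depends on the choice, as products are unique up to a unique isomorphism
  compatible with the projections.\<close>

definition prod_cone :: "('o, 'm) category \<Rightarrow> 'o \<Rightarrow> 'o \<Rightarrow> 'o \<times> 'm \<times> 'm" where
  "prod_cone C X Y = (SOME (P, p, q). is_binary_product C X Y P p q)"

definition product_obj :: "('o, 'm) category \<Rightarrow> 'o \<Rightarrow> 'o \<Rightarrow> 'o" where
  "product_obj C X Y = fst (prod_cone C X Y)"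

definition proj1 :: "('o, 'm) category \<Rightarrow> 'o \<Rightarrow> 'o \<Rightarrow> 'm" where
  "proj1 C X Y = fst (snd (prod_cone C X Y))"

definition proj2 :: "('o, 'm) category \<Rightarrow> 'o \<Rightarrow> 'o \<Rightarrow> 'm" where
  "proj2 C X Y = snd (snd (prod_cone C X Y))"

text \<open>The morphism \<open>(x, y): S \<rightarrow> X \<times> Y\<close> for \<open>x: S \<rightarrow> X\<close> and \<open>y: S \<rightarrow> Y\<close>.\<close>

definition pairing :: "('o, 'm) category \<Rightarrow> 'm \<Rightarrow> 'm \<Rightarrow> 'm" where
  "pairing C x y = (THE h. h \<in> Hom C (Dom C x) (product_obj C (Cod C x) (Cod C y)) \<and>
    proj1 C (Cod C x) (Cod C y) \<odot>\<^bsub>C\<^esub> h = x \<and>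
    proj2 C (Cod C x) (Cod C y) \<odot>\<^bsub>C\<^esub> h = y)"

locale pointed_category = category +
  assumes zero_object: "\<exists>O'. is_zero_object C O'"

locale centralic_category = pointed_category +
  assumes finite_products: "has_finite_products C"
    and centralic: "\<lbrakk>X \<in> Obj C; Y \<in> Obj C; Z \<in> Obj C; S \<in> Obj C;
      f \<in> Hom C (product_obj C X Y) Z; x \<in> Hom C S X; x' \<in> Hom C S X; y \<in> Hom C S Y;
      f \<odot> pairing C x (zero_mor C S Y) = f \<odot> pairing C x' (zero_mor C S Y)\<rbrakk> \<Longrightarrow>
      f \<odot> pairing C x y = f \<odot> pairing C x' y"

definition is_cooperator :: "('o, 'm) category \<Rightarrow> 'm \<Rightarrow> 'm \<Rightarrow> 'm \<Rightarrow> bool" where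
  "is_cooperator C f g \<rho> \<longleftrightarrow> (let A = Dom C f; B = Dom C g in
    \<rho> \<in> Hom C (product_obj C A B) (Cod C f) \<and>
    \<rho> \<odot>\<^bsub>C\<^esub> pairing C (Ide C A) (zero_mor C A B) = f \<and>
    \<rho> \<odot>\<^bsub>C\<^esub> pairing C (zero_mor C B A) (Ide C B) = g)"

definition commute :: "('o, 'm) category \<Rightarrow> 'm \<Rightarrow> 'm \<Rightarrow> bool" where
  "commute C f g \<longleftrightarrow> f \<in> Mor C \<and> g \<in> Mor C \<and> Cod C f = Cod C g \<and>
    (\<exists>\<rho>. is_cooperator C f g \<rho>)"

definition central :: "('o, 'm) category \<Rightarrow> 'm \<Rightarrow> bool" where
  "central C f \<longleftrightarrow> f \<in> Mor C \<and> commute C f (Ide C (Cod C f))"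

definition central_morphisms :: "('o, 'm) category \<Rightarrow> 'm set" where
  "central_morphisms C = {f. central C f}"

definition right_ideal :: "('o, 'm) category \<Rightarrow> 'm set \<Rightarrow> bool" where
  "right_ideal C I \<longleftrightarrow> I \<subseteq> Mor C \<and>
    (\<forall>X\<in>Obj C. \<forall>Y\<in>Obj C. \<forall>S\<in>Obj C. \<forall>f\<in>Hom C X Y. \<forall>x\<in>Hom C S X.
      f \<in> I \<longrightarrow> f \<odot>\<^bsub>C\<^esub> x \<in> I)"

end

theory Submission imports Defs
begin

text \<open>Precomposition with \<open>x: S \<rightarrow> X\<close> turns a cooperator into a cooperator. If
  \<open>\<rho>: X \<times> B \<rightarrow> Y\<close> satisfies \<open>\<rho>(1, 0) = f\<close> and \<open>\<rho>(0, 1) = g\<close>, then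
  \<open>\<sigma> = \<rho> \<circ> (x \<times> 1): S \<times> B \<rightarrow> Y\<close> satisfies \<open>\<sigma>(1, 0) = \<rho>(x, 0) = \<rho>(1, 0) \<circ> x = f \<circ> x\<close> and
  \<open>\<sigma>(0, 1) = \<rho>(x \<circ> 0, 1) = \<rho>(0, 1) = g\<close>, because zero morphisms absorb composition on either side.
  So \<open>f \<circ> x\<close> commutes with everything that \<open>f\<close> commutes with (\<open>commute_Comp\<close>), and a
  central \<open>f\<close> is the case in which \<open>g\<close> is the identity of its codomain.\<close>

lemma HomD:
  assumes "f \<in> Hom C X Y"
  shows "f \<in> Mor C" "Dom C f = X" "Cod C f = Y"
  using assms by (auto simp: Hom_def)

context category
begin

lemma Hom_Dom_in_Obj: "f \<in> Hom C X Y \<Longrightarrow> X \<in> Obj C"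
  using Dom_in_Obj by (auto simp: Hom_def)

lemma Hom_Cod_in_Obj: "f \<in> Hom C X Y \<Longrightarrow> Y \<in> Obj C"
  using Cod_in_Obj by (auto simp: Hom_def)

lemma to_zero_object_ex1:
  assumes "is_zero_object C Z" and "X \<in> Obj C"
  shows "\<exists>!u. u \<in> Hom C X Z"
  using assms by (simp add: is_zero_object_def)

lemma from_zero_object_ex1:
  assumes "is_zero_object C Z" and "X \<in> Obj C"
  shows "\<exists>!v. v \<in> Hom C Z X"
  using assms by (simp add: is_zero_object_def)

text \<open>Any two zero objects are linked by a unique morphism, which is compatible with the
  morphisms into and out of them; hence the zero morphism does not depend on the zero
  object through which it factors.\<close>

lemma zero_mor_eq_Comp:
  assumes Z: "is_zero_object C Z" and u: "u \<in> Hom C X Z" and v: "v \<in> Hom C Z Y"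
  shows "zero_mor C X Y = v \<odot> u"
  unfolding zero_mor_def
proof (rule the_equality)
  show "\<exists>O' u' v'. is_zero_object C O' \<and> u' \<in> Hom C X O' \<and> v' \<in> Hom C O' Y \<and> v \<odot> u = v' \<odot> u'"
    using assms by blast
next
  fix z
  assume "\<exists>O' u v. is_zero_object C O' \<and> u \<in> Hom C X O' \<and> v \<in> Hom C O' Y \<and> z = v \<odot> u"
  then obtain Z' u' v' where Z': "is_zero_object C Z'" and u': "u' \<in> Hom C X Z'"
    and v': "v' \<in> Hom C Z' Y" and z: "z = v' \<odot> u'"
    by blast
  obtain w where w: "w \<in> Hom C Z Z'"
    using ex1_implies_ex[OF from_zero_object_ex1[OF Z Hom_Cod_in_Obj[OF u']]] by auto
  have "w \<odot> u = u'"
    using to_zero_object_ex1[OF Z' Hom_Dom_in_Obj[OF u]] Comp_in_Hom[OF u w] u' by blast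
  moreover have "v' \<odot> w = v"
    using from_zero_object_ex1[OF Z Hom_Cod_in_Obj[OF v]] Comp_in_Hom[OF w v'] v by blast
  ultimately show "z = v \<odot> u"
    using Comp_assoc[OF u w v'] z by simp
qed

end

context pointed_category
begin

lemma zero_mor_factorisation:
  assumes "X \<in> Obj C" and "Y \<in> Obj C"
  obtains Z u v where "is_zero_object C Z" "u \<in> Hom C X Z" "v \<in> Hom C Z Y"
    "zero_mor C X Y = v \<odot> u"
proof -
  obtain Z where Z: "is_zero_object C Z"
    using zero_object by blast
  have "\<exists>u. u \<in> Hom C X Z" "\<exists>v. v \<in> Hom C Z Y"
    using to_zero_object_ex1[OF Z assms(1)] from_zero_object_ex1[OF Z assms(2)]
    by (simp_all add: ex1_implies_ex)
  then obtain u v where u: "u \<in> Hom C X Z" and v: "v \<in> Hom C Z Y"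
    by auto
  show thesis
    by (rule that[OF Z u v zero_mor_eq_Comp[OF Z u v]])
qed

lemma zero_mor_in_Hom:
  assumes "X \<in> Obj C" and "Y \<in> Obj C"
  shows "zero_mor C X Y \<in> Hom C X Y"
  by (rule zero_mor_factorisation[OF assms]) (simp add: Comp_in_Hom)

lemma Comp_zero_mor:
  assumes "W \<in> Obj C" and f: "f \<in> Hom C X Y"
  shows "f \<odot> zero_mor C W X = zero_mor C W Y"
proof -
  obtain Z u v where Z: "is_zero_object C Z" and u: "u \<in> Hom C W Z" and v: "v \<in> Hom C Z X"
    and eq: "zero_mor C W X = v \<odot> u"
    by (rule zero_mor_factorisation[OF assms(1) Hom_Dom_in_Obj[OF f]])
  show ?thesis
    using zero_mor_eq_Comp[OF Z u Comp_in_Hom[OF v f]] Comp_assoc[OF u v f] eq by simp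
qed

lemma zero_mor_Comp:
  assumes "Z \<in> Obj C" and f: "f \<in> Hom C X Y"
  shows "zero_mor C Y Z \<odot> f = zero_mor C X Z"
proof -
  obtain O' u v where O': "is_zero_object C O'" and u: "u \<in> Hom C Y O'" and v: "v \<in> Hom C O' Z"
    and eq: "zero_mor C Y Z = v \<odot> u"
    by (rule zero_mor_factorisation[OF Hom_Cod_in_Obj[OF f] assms(1)])
  show ?thesis
    using zero_mor_eq_Comp[OF O' Comp_in_Hom[OF f u] v] Comp_assoc[OF f u v] eq by simp
qed

end

context category
begin

lemma binary_product_of_finite_products:
  assumes fp: "has_finite_products C" and X: "X \<in> Obj C" and Y: "Y \<in> Obj C"
  shows "\<exists>P p q. is_binary_product C X Y P p q"
proof -
  have all2: "(\<forall>i\<in>{..<2::nat}. Q i) \<longleftrightarrow> Q 0 \<and> Q 1" for Q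
    by (auto simp: less_2_cases_iff)
  let ?X = "\<lambda>i::nat. if i = 0 then X else Y"
  have "\<exists>P p. is_product C {..<2} ?X P p"
    by (rule fp[unfolded has_finite_products_def, rule_format]) (simp add: X Y)
  then obtain P p where prod: "is_product C {..<2} ?X P p"
    by blast
  have "\<exists>!h. h \<in> Hom C S P \<and> p 0 \<odot> h = x \<and> p 1 \<odot> h = y"
    if S: "S \<in> Obj C" and x: "x \<in> Hom C S X" and y: "y \<in> Hom C S Y" for S x y
  proof -
    have "\<forall>t. (\<forall>i\<in>{..<2}. t i \<in> Hom C S (?X i)) \<longrightarrow>
        (\<exists>!h. h \<in> Hom C S P \<and> (\<forall>i\<in>{..<2}. p i \<odot> h = t i))"
      using prod S unfolding is_product_def by blast
    from this[rule_format, of "\<lambda>i. if i = 0 then x else y"] show ?thesis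
      using x y by (simp add: all2)
  qed
  then have "is_binary_product C X Y P (p 0) (p 1)"
    using prod unfolding is_product_def is_binary_product_def all2 by simp
  then show ?thesis
    by blast
qed

lemma product_obj_is_binary_product:
  assumes "has_finite_products C" and "X \<in> Obj C" and "Y \<in> Obj C"
  shows "is_binary_product C X Y (product_obj C X Y) (proj1 C X Y) (proj2 C X Y)"
proof -
  have "case prod_cone C X Y of (P, p, q) \<Rightarrow> is_binary_product C X Y P p q"
    unfolding prod_cone_def
    by (rule someI_ex) (use binary_product_of_finite_products[OF assms] in auto)
  then show ?thesis
    by (simp add: product_obj_def proj1_def proj2_def case_prod_beta)
qed

lemma proj1_in_Hom:
  assumes "has_finite_products C" and "X \<in> Obj C" and "Y \<in> Obj C"
  shows "proj1 C X Y \<in> Hom C (product_obj C X Y) X"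
  using product_obj_is_binary_product[OF assms] by (simp add: is_binary_product_def)

lemma proj2_in_Hom:
  assumes "has_finite_products C" and "X \<in> Obj C" and "Y \<in> Obj C"
  shows "proj2 C X Y \<in> Hom C (product_obj C X Y) Y"
  using product_obj_is_binary_product[OF assms] by (simp add: is_binary_product_def)

lemma pairing_ex1:
  assumes "has_finite_products C" and x: "x \<in> Hom C S X" and y: "y \<in> Hom C S Y"
  shows "\<exists>!h. h \<in> Hom C S (product_obj C X Y) \<and> proj1 C X Y \<odot> h = x \<and> proj2 C X Y \<odot> h = y"
  using product_obj_is_binary_product[OF assms(1) Hom_Cod_in_Obj[OF x] Hom_Cod_in_Obj[OF y]]
    Hom_Dom_in_Obj[OF x] x y
  unfolding is_binary_product_def by blast

lemma pairing_spec:
  assumes "has_finite_products C" and x: "x \<in> Hom C S X" and y: "y \<in> Hom C S Y"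
  shows "pairing C x y \<in> Hom C S (product_obj C X Y)"
    and "proj1 C X Y \<odot> pairing C x y = x"
    and "proj2 C X Y \<odot> pairing C x y = y"
  using theI'[OF pairing_ex1[OF assms]] HomD[OF x] HomD[OF y]
  by (simp_all add: pairing_def)

lemma pairing_unique:
  assumes fp: "has_finite_products C" and x: "x \<in> Hom C S X" and y: "y \<in> Hom C S Y"
    and "h \<in> Hom C S (product_obj C X Y)" "proj1 C X Y \<odot> h = x" "proj2 C X Y \<odot> h = y"
  shows "h = pairing C x y"
  using pairing_ex1[OF fp x y] pairing_spec[OF fp x y] assms(4-) by blast

lemma pairing_Comp:
  assumes fp: "has_finite_products C" and x: "x \<in> Hom C S X" and y: "y \<in> Hom C S Y"
    and h: "h \<in> Hom C T S"
  shows "pairing C x y \<odot> h = pairing C (x \<odot> h) (y \<odot> h)"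
proof (rule pairing_unique[OF fp Comp_in_Hom[OF h x] Comp_in_Hom[OF h y]])
  note X = Hom_Cod_in_Obj[OF x] and Y = Hom_Cod_in_Obj[OF y]
  note xy = pairing_spec[OF fp x y]
  show "pairing C x y \<odot> h \<in> Hom C T (product_obj C X Y)"
    using Comp_in_Hom[OF h xy(1)] .
  show "proj1 C X Y \<odot> (pairing C x y \<odot> h) = x \<odot> h"
    using Comp_assoc[OF h xy(1) proj1_in_Hom[OF fp X Y]] xy(2) by simp
  show "proj2 C X Y \<odot> (pairing C x y \<odot> h) = y \<odot> h"
    using Comp_assoc[OF h xy(1) proj2_in_Hom[OF fp X Y]] xy(3) by simp
qed

end

context pointed_category
begin

text \<open>The new cooperator is the old one precomposed with \<open>x \<times> 1\<close>; evaluating it on any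
  pair replaces the first component \<open>a\<close> by \<open>x \<circ> a\<close>, which gives both required equations.\<close>

lemma commute_Comp:
  assumes fp: "has_finite_products C" and comm: "commute C f g"
    and f: "f \<in> Hom C X Y" and x: "x \<in> Hom C S X"
  shows "commute C (f \<odot> x) g"
proof -
  define B where "B = Dom C g"
  have g: "g \<in> Hom C B Y"
    using comm HomD[OF f] by (simp add: commute_def B_def Hom_def)
  have objs: "X \<in> Obj C" "S \<in> Obj C" "B \<in> Obj C"
    using Hom_Dom_in_Obj f x g by blast+
  obtain \<rho> where \<rho>: "\<rho> \<in> Hom C (product_obj C X B) Y"
    and \<rho>f: "\<rho> \<odot> pairing C (Ide C X) (zero_mor C X B) = f"
    and \<rho>g: "\<rho> \<odot> pairing C (zero_mor C B X) (Ide C B) = g"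
    using comm HomD[OF f] HomD[OF g] by (auto simp: commute_def is_cooperator_def)
  define SB where "SB = product_obj C S B"
  note p = proj1_in_Hom[OF fp objs(2,3), folded SB_def]
    and q = proj2_in_Hom[OF fp objs(2,3), folded SB_def]
  \<comment> \<open>The product morphism \<open>x \<times> 1\<close>, written as the pairing \<open>(x \<circ> p, q)\<close> of the projections.\<close>
  define m where "m = pairing C (x \<odot> proj1 C S B) (proj2 C S B)"
  have m: "m \<in> Hom C SB (product_obj C X B)"
    unfolding m_def by (rule pairing_spec(1)[OF fp Comp_in_Hom[OF p x] q])
  have m_pairing: "(\<rho> \<odot> m) \<odot> pairing C a b = \<rho> \<odot> pairing C (x \<odot> a) b"
    if a: "a \<in> Hom C T S" and b: "b \<in> Hom C T B" for T a b
  proof -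
    note ab = pairing_spec[OF fp a b, folded SB_def]
    have "m \<odot> pairing C a b = pairing C (x \<odot> a) b"
      unfolding m_def pairing_Comp[OF fp Comp_in_Hom[OF p x] q ab(1)]
      using Comp_assoc[OF ab(1) p x] ab by simp
    then show ?thesis
      using Comp_assoc[OF ab(1) m \<rho>] by simp
  qed
  note zeros = zero_mor_in_Hom[OF objs(2,3)] zero_mor_in_Hom[OF objs(3,2)]
    zero_mor_in_Hom[OF objs(1,3)]
  note ides = Ide_in_Hom[OF objs(1)] Ide_in_Hom[OF objs(2)] Ide_in_Hom[OF objs(3)]
  note fx = Comp_in_Hom[OF x f]
  have "(\<rho> \<odot> m) \<odot> pairing C (Ide C S) (zero_mor C S B) = \<rho> \<odot> pairing C x (zero_mor C S B)"
    using m_pairing[OF ides(2) zeros(1)] Comp_Ide[OF x] by simp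
  also have "\<dots> = \<rho> \<odot> (pairing C (Ide C X) (zero_mor C X B) \<odot> x)"
    using pairing_Comp[OF fp ides(1) zeros(3) x] Ide_Comp[OF x] zero_mor_Comp[OF objs(3) x]
    by simp
  also have "\<dots> = f \<odot> x"
    using Comp_assoc[OF x pairing_spec(1)[OF fp ides(1) zeros(3)] \<rho>] \<rho>f by simp
  finally have 1: "(\<rho> \<odot> m) \<odot> pairing C (Ide C S) (zero_mor C S B) = f \<odot> x" .
  have 2: "(\<rho> \<odot> m) \<odot> pairing C (zero_mor C B S) (Ide C B) = g"
    using m_pairing[OF zeros(2) ides(3)] Comp_zero_mor[OF objs(3) x] \<rho>g by simp
  have "is_cooperator C (f \<odot> x) g (\<rho> \<odot> m)"
    using 1 2 Comp_in_Hom[OF m \<rho>] HomD[OF fx] HomD[OF g]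
    by (simp add: is_cooperator_def SB_def)
  then show ?thesis
    using HomD[OF fx] HomD[OF g] by (auto simp: commute_def)
qed

end

theorem proposition3p4:
  fixes C :: "('o, 'm) category"
  assumes "centralic_category C"
  shows "right_ideal C (central_morphisms C)"
proof -
  interpret centralic_category C by fact
  have "central C (f \<odot>\<^bsub>C\<^esub> x)"
    if "central C f" and f: "f \<in> Hom C X Y" and x: "x \<in> Hom C S X" for f x X Y S
    using commute_Comp[OF finite_products _ f x] that(1) HomD[OF f] HomD[OF Comp_in_Hom[OF x f]]
    by (simp add: central_def)
  then show ?thesis
    unfolding right_ideal_def central_morphisms_def by (auto simp: central_def)
qed

end
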